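(* Let $V$ be a finite ground set, let $f:2^V\to\mathbb{R}_{\ge 0}$ be normalized, monotone and submodular, and let $\mathcal{A}$ be a subroutine satisfying the $\beta$-iterative property for some $\beta\ge 1$. Let $k$ be a budget and let $\tau,\eta$ be parameters with $\eta\in\mathbb{N}_+$, $\eta\ge 4(\log k+1)$ and $2\le \tau\le \frac{k}{3\eta(\log k+2)}$. Then PRo (run with inputs $V,k,\tau,\eta,\mathcal{A}$) returns a set $S=S_0\cup S_1$ of size $k$ such that, writing $$c:=\frac{\eta}{5\beta^3\lceil\log\tau\rceil+\eta}\left(1-e^{-\frac{k-|S_0|}{\beta(k-\tau)}}\right),$$ we have $$f(S\setminus E^*_S)\ \ge\ \frac{c}{1+c}\; f\big(\mathrm{OPT}(k,V,\tau)\setminus E^*_{\mathrm{OPT}(k,V,\tau)}\big).$$ In addition, if $\tau=o\!\left(\frac{k}{\eta\log k}\right)$ and $\eta\ge\log^2 k$, then as $k\to\infty$, $$f(S\setminus E^*_S)\ \ge\ \left(\frac{1-e^{-1/\beta}}{2-e^{-1/\beta}}+o(1)\right) f\big(\mathrm{OPT}(k,V,\tau)\setminus E^*_{\mathrm{OPT}(k,V,\tau)}\big).$$ In particular, with the greedy algorithm as subroutine ($\beta=1$) the asymptotic approximation factor is at least $0.387$, and with a subroutine satisfying the $\beta$-iterative property with $\beta=1/(1-\epsilon)$ (such as Thresholding-Greedy with parameter $\epsilon$) it is at least $0.387(1-\epsilon)$.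
   Context: Notation: $f$ is normalized if $f(\emptyset)=0$; $f(Y\mid X):=f(X\cup Y)-f(X)$ and $f(e\mid X):=f(\{e\}\mid X)$. All logarithms are to base 2. A subroutine $\mathcal{A}(k',T)$ takes a cardinality $k'$ and a set $T\subseteq V$ and outputs an ordered set $(v_1,\dots,v_{k'})$ of elements of $T$; write $\mathcal{A}_i(T)=\{v_1,\dots,v_i\}$. $\mathcal{A}$ satisfies the $\beta$-iterative property if for every $T$, every output size and every $i$, $f(\mathcal{A}_{i+1}(T))-f(\mathcal{A}_i(T))\ge \frac{1}{\beta}\max_{v\in T} f(v\mid \mathcal{A}_i(T))$. (The standard greedy algorithm, which adds an element of maximum marginal gain at each step, satisfies it with $\beta=1$.) Algorithm PRo (inputs $V,k,\tau,\eta\in\mathbb{N}_+,\mathcal{A}$): set $S_0\leftarrow\emptyset$; for $i=0,1,\dots,\lceil\log\tau\rceil$ and, for each such $i$, for $j=1,\dots,\lceil\tau/2^i\rceil$: let $B_j\leftarrow\mathcal{A}(2^i\eta, V\setminus S_0)$ and $S_0\leftarrow S_0\cup B_j$. Then $S_1\leftarrow\mathcal{A}(k-|S_0|, V\setminus S_0)$, and output $S=S_0\cup S_1$. For $k$ and $T\subseteq V$, $\mathrm{OPT}(k,V,\tau)\in\arg\max_{S\subseteq V,|S|=k}\min_{E\subseteq S,|E|\le\tau} f(S\setminus E)$, and for a set $S$, $E^*_S\in\arg\min_{E\subseteq S,|E|\le\tau} f(S\setminus E)$. *)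

theory Defs
  imports Complex_Main "HOL-Library.Landau_Symbols"
begin

definition sf_normalized :: "('a set \<Rightarrow> real) \<Rightarrow> bool" where
  "sf_normalized f \<longleftrightarrow> f {} = 0"

definition sf_nonneg :: "'a set \<Rightarrow> ('a set \<Rightarrow> real) \<Rightarrow> bool" where
  "sf_nonneg V f \<longleftrightarrow> (\<forall>X. X \<subseteq> V \<longrightarrow> 0 \<le> f X)"

definition sf_monotone :: "'a set \<Rightarrow> ('a set \<Rightarrow> real) \<Rightarrow> bool" where
  "sf_monotone V f \<longleftrightarrow> (\<forall>X Y. X \<subseteq> Y \<longrightarrow> Y \<subseteq> V \<longrightarrow> f X \<le> f Y)"

definition sf_submodular :: "'a set \<Rightarrow> ('a set \<Rightarrow> real) \<Rightarrow> bool" where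
  "sf_submodular V f \<longleftrightarrow>
     (\<forall>X Y. X \<subseteq> V \<longrightarrow> Y \<subseteq> V \<longrightarrow> f (X \<union> Y) + f (X \<inter> Y) \<le> f X + f Y)"

definition marg :: "('a set \<Rightarrow> real) \<Rightarrow> 'a \<Rightarrow> 'a set \<Rightarrow> real" where
  "marg f e X = f (insert e X) - f X"

text \<open>A subroutine: given a cardinality k' and a set T, it returns an ordered set
  (a list without repetitions) of k' elements of T.  A_i(T) is the set of its first i elements.\<close>

definition sub_prefix :: "(nat \<Rightarrow> 'a set \<Rightarrow> 'a list) \<Rightarrow> nat \<Rightarrow> 'a set \<Rightarrow> nat \<Rightarrow> 'a set" where
  "sub_prefix A k' T i = set (take i (A k' T))"

definition valid_subroutine :: "'a set \<Rightarrow> (nat \<Rightarrow> 'a set \<Rightarrow> 'a list) \<Rightarrow> bool" where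
  "valid_subroutine V A \<longleftrightarrow>
     (\<forall>T k'. T \<subseteq> V \<longrightarrow> k' \<le> card T \<longrightarrow>
        length (A k' T) = k' \<and> distinct (A k' T) \<and> set (A k' T) \<subseteq> T)"

definition beta_iterative ::
  "'a set \<Rightarrow> ('a set \<Rightarrow> real) \<Rightarrow> (nat \<Rightarrow> 'a set \<Rightarrow> 'a list) \<Rightarrow> real \<Rightarrow> bool" where
  "beta_iterative V f A \<beta> \<longleftrightarrow>
     (\<forall>T k' i. T \<subseteq> V \<longrightarrow> k' \<le> card T \<longrightarrow> i < k' \<longrightarrow>
        f (sub_prefix A k' T (Suc i)) - f (sub_prefix A k' T i)
          \<ge> (1 / \<beta>) * Max ((\<lambda>v. marg f v (sub_prefix A k' T i)) ` T))"

definition pro_step :: "'a set \<Rightarrow> nat \<Rightarrow> (nat \<Rightarrow> 'a set \<Rightarrow> 'a list) \<Rightarrow> nat \<Rightarrow> 'a set \<Rightarrow> 'a set" where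
  "pro_step V \<eta> A i S0 = S0 \<union> set (A (2 ^ i * \<eta>) (V - S0))"

definition pro_S0 :: "'a set \<Rightarrow> nat \<Rightarrow> nat \<Rightarrow> (nat \<Rightarrow> 'a set \<Rightarrow> 'a list) \<Rightarrow> 'a set" where
  "pro_S0 V \<tau> \<eta> A =
     fold (\<lambda>i S0. (pro_step V \<eta> A i ^^ nat \<lceil>real \<tau> / 2 ^ i\<rceil>) S0)
          [0..<nat \<lceil>log 2 (real \<tau>)\<rceil> + 1] {}"

definition pro_S1 :: "'a set \<Rightarrow> nat \<Rightarrow> nat \<Rightarrow> nat \<Rightarrow> (nat \<Rightarrow> 'a set \<Rightarrow> 'a list) \<Rightarrow> 'a set" where
  "pro_S1 V k \<tau> \<eta> A =
     (let S0 = pro_S0 V \<tau> \<eta> A in set (A (k - card S0) (V - S0)))"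

definition PRo :: "'a set \<Rightarrow> nat \<Rightarrow> nat \<Rightarrow> nat \<Rightarrow> (nat \<Rightarrow> 'a set \<Rightarrow> 'a list) \<Rightarrow> 'a set" where
  "PRo V k \<tau> \<eta> A = pro_S0 V \<tau> \<eta> A \<union> pro_S1 V k \<tau> \<eta> A"

definition robust_val :: "('a set \<Rightarrow> real) \<Rightarrow> nat \<Rightarrow> 'a set \<Rightarrow> real" where
  "robust_val f \<tau> S = Min ((\<lambda>E. f (S - E)) ` {E. E \<subseteq> S \<and> card E \<le> \<tau>})"

definition opt_robust_val :: "('a set \<Rightarrow> real) \<Rightarrow> 'a set \<Rightarrow> nat \<Rightarrow> nat \<Rightarrow> real" where
  "opt_robust_val f V k \<tau> = Max (robust_val f \<tau> ` {S. S \<subseteq> V \<and> card S = k})"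

definition pro_constant :: "real \<Rightarrow> nat \<Rightarrow> nat \<Rightarrow> nat \<Rightarrow> nat \<Rightarrow> real" where
  "pro_constant \<beta> k \<tau> \<eta> s0 =
     real \<eta> / (5 * \<beta> ^ 3 * real_of_int \<lceil>log 2 (real \<tau>)\<rceil> + real \<eta>)
     * (1 - exp (- (real k - real s0) / (\<beta> * (real k - real \<tau>))))"

end

theory Submission
  imports Defs "HOL-Analysis.Convex"
begin

text \<open>
  Let \<open>E\<close> be the deleted set and \<open>x\<close> the remaining value.  The greedy bound for \<open>S\<^sub>1\<close>, together with
  the fact that the optimum loses at most \<open>x\<close> when \<open>S\<^sub>0\<close> is removed from the ground set, gives
  \<open>f S\<^sub>1 \<ge> \<alpha> (OPT - x)\<close>, so it suffices that \<open>x \<ge> \<mu> f S\<^sub>1\<close> with \<open>\<mu> = \<eta> / (5 \<beta>\<^sup>3 L + \<eta>)\<close> and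
  \<open>L = \<lceil>log \<tau>\<rceil>\<close>.  If \<open>E\<close> meets \<open>S\<^sub>1\<close>, then fewer than \<open>\<tau>\<close> deletions hit \<open>S\<^sub>0\<close>, so at each level \<open>i\<close>
  some bucket of size \<open>2\<^sup>i \<eta>\<close> loses fewer than \<open>2\<^sup>i\<close> elements.  What is lost at level \<open>i + 1\<close> has
  marginal value at most \<open>2 \<beta> x / (\<eta> - 1)\<close> over the complete bucket of level \<open>i\<close>; telescoping over
  the levels bounds the marginal value of \<open>E \<inter> S\<^sub>1\<close> over the remaining set by
  \<open>(2 L + 1) \<beta> x / (\<eta> - 1)\<close>.
\<close>

section \<open>Monotone submodular functions\<close>

locale submodular_fn =
  fixes V :: "'a set" and f :: "'a set \<Rightarrow> real"
  assumes fin: "finite V" and norm: "f {} = 0"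
    and mono: "\<And>X Y. X \<subseteq> Y \<Longrightarrow> Y \<subseteq> V \<Longrightarrow> f X \<le> f Y"
    and submod: "\<And>X Y. X \<subseteq> V \<Longrightarrow> Y \<subseteq> V \<Longrightarrow> f (X \<union> Y) + f (X \<inter> Y) \<le> f X + f Y"
begin

lemma nonneg: "X \<subseteq> V \<Longrightarrow> 0 \<le> f X"
  using mono[of "{}" X] norm by simp

lemma marg_antimono:
  assumes "X \<subseteq> Y" "Y \<subseteq> V" "v \<in> V"
  shows "marg f v Y \<le> marg f v X"
proof (cases "v \<in> Y")
  case True
  then show ?thesis using mono[of X "insert v X"] assms
    by (auto simp: marg_def insert_absorb)
next
  case False
  then have "insert v X \<inter> Y = X" "insert v X \<union> Y = insert v Y" using assms by auto
  then show ?thesis using submod[of "insert v X" Y] assms subset_trans[OF assms(1,2)]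
    by (simp add: marg_def)
qed

text \<open>Submodularity is applied to \<open>X \<union> N\<close> and \<open>Y\<close>, whose
  intersection contains \<open>X\<close>. Monotonicity absorbs the part of \<open>N\<close> inside
  \<open>Y\<close>, so the two sets may overlap.\<close>

lemma gain_antimono:
  assumes "X \<subseteq> Y" "Y \<subseteq> V" "N \<subseteq> V"
  shows "f (Y \<union> N) - f Y \<le> f (X \<union> N) - f X"
proof -
  have "(X \<union> N) \<union> Y = Y \<union> N" using assms by auto
  moreover have "f X \<le> f ((X \<union> N) \<inter> Y)" using assms by (intro mono) auto
  ultimately show ?thesis
    using submod[of "X \<union> N" Y] assms subset_trans[OF assms(1,2)] by simp
qed

lemma gain_le_sum_marg:
  assumes "X \<subseteq> V" "N \<subseteq> V"
  shows "f (X \<union> N) - f X \<le> (\<Sum>v\<in>N. marg f v X)"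
proof -
  have "finite N" using assms fin finite_subset by blast
  then show ?thesis using assms
  proof (induction N)
    case (insert v N)
    have "marg f v (X \<union> N) \<le> marg f v X" using insert by (intro marg_antimono) auto
    then show ?case using insert by (simp add: marg_def)
  qed simp
qed

lemma gain_le_card:
  assumes "X \<subseteq> V" "N \<subseteq> V" "\<And>v. v \<in> N \<Longrightarrow> marg f v X \<le> d"
  shows "f (X \<union> N) - f X \<le> real (card N) * d"
  using gain_le_sum_marg[OF assms(1,2)] sum_bounded_above[of N "\<lambda>v. marg f v X" d] assms(3)
  by force

text \<open>Deleting an element of the list loses one gain; the gains of the survivors only increase.\<close>

lemma remaining_value_ge:
  assumes "distinct ls" "set ls \<subseteq> V"
    and "\<And>t. t < length ls \<Longrightarrow> d \<le> f (set (take (Suc t) ls)) - f (set (take t ls))"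
  shows "(real (length ls) - real (card (E \<inter> set ls))) * d \<le> f (set ls - E)"
  using assms
proof (induction ls rule: rev_induct)
  case Nil
  then show ?case by (simp add: norm)
next
  case (snoc v ls)
  have IH: "(real (length ls) - real (card (E \<inter> set ls))) * d \<le> f (set ls - E)"
  proof (rule snoc.IH)
    fix t assume "t < length ls"
    then show "d \<le> f (set (take (Suc t) ls)) - f (set (take t ls))"
      using snoc.prems(3)[of t] by simp
  qed (use snoc.prems in auto)
  have d: "d \<le> marg f v (set ls)" using snoc.prems(3)[of "length ls"] by (simp add: marg_def)
  show ?case
  proof (cases "v \<in> E")
    case True
    then have "set (ls @ [v]) - E = set ls - E"
      and "E \<inter> set (ls @ [v]) = insert v (E \<inter> set ls)" by auto
    moreover from this have "card (E \<inter> set (ls @ [v])) = Suc (card (E \<inter> set ls))"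
      using snoc.prems(1) by simp
    ultimately show ?thesis using IH by simp
  next
    case False
    then have 1: "set (ls @ [v]) - E = insert v (set ls - E)" "E \<inter> set (ls @ [v]) = E \<inter> set ls"
      by auto
    have "marg f v (set ls) \<le> marg f v (set ls - E)"
      using snoc.prems by (intro marg_antimono) auto
    then show ?thesis using IH d unfolding 1 by (simp add: marg_def algebra_simps)
  qed
qed

end

section \<open>Lists built by an iterative subroutine\<close>

text \<open>The candidates \<open>R\<close> are kept apart from the set the list was drawn from, so
  that they can shrink as later buckets are removed. Quantifying over candidates instead of taking
  their maximum makes the property pass to subsets.\<close>

definition iterative_list :: "('a set \<Rightarrow> real) \<Rightarrow> real \<Rightarrow> 'a list \<Rightarrow> 'a set \<Rightarrow> bool" where
  "iterative_list f \<beta> ls R \<longleftrightarrow> (\<forall>t < length ls. \<forall>v \<in> R.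
     marg f v (set (take t ls)) \<le> \<beta> * (f (set (take (Suc t) ls)) - f (set (take t ls))))"

lemma iterative_list_subset:
  "iterative_list f \<beta> ls R \<Longrightarrow> R' \<subseteq> R \<Longrightarrow> iterative_list f \<beta> ls R'"
  unfolding iterative_list_def by blast

locale iterative_subroutine = submodular_fn V f for V :: "'a set" and f :: "'a set \<Rightarrow> real" +
  fixes A :: "nat \<Rightarrow> 'a set \<Rightarrow> 'a list" and \<beta> :: real
  assumes valid: "valid_subroutine V A" and iter: "beta_iterative V f A \<beta>" and beta: "1 \<le> \<beta>"
begin

lemma subroutine_list:
  assumes "T \<subseteq> V" "k' \<le> card T"
  shows "length (A k' T) = k'" "distinct (A k' T)" "set (A k' T) \<subseteq> T"
  using valid assms unfolding valid_subroutine_def by blast+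

lemma iterative_list_subroutine:
  assumes "T \<subseteq> V" "k' \<le> card T"
  shows "iterative_list f \<beta> (A k' T) T"
  unfolding iterative_list_def
proof (intro allI impI ballI)
  fix t v assume t: "t < length (A k' T)" and v: "v \<in> T"
  let ?P = "\<lambda>t. set (take t (A k' T))"
  have "finite T" using assms fin finite_subset by blast
  then have "marg f v (?P t) \<le> Max ((\<lambda>v. marg f v (?P t)) ` T)" using v by (intro Max_ge) auto
  moreover have "(1 / \<beta>) * Max ((\<lambda>v. marg f v (?P t)) ` T) \<le> f (?P (Suc t)) - f (?P t)"
    using iter assms t subroutine_list(1)[OF assms]
    unfolding beta_iterative_def sub_prefix_def by metis
  ultimately show "marg f v (?P t) \<le> \<beta> * (f (?P (Suc t)) - f (?P t))"
    using beta by (simp add: field_simps)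
qed

text \<open>Every gain along the list is at least the marginal value of an outside element divided by
  \<open>\<beta>\<close>, hence so is the average gain of the surviving elements.  Comparing with the survivors
  instead of the whole list avoids a loss that is exponential in the number of levels.\<close>

lemma marg_le_remaining:
  assumes "iterative_list f \<beta> ls R" "distinct ls" "set ls \<subseteq> V" "v \<in> R" "v \<in> V"
  shows "(real (length ls) - real (card (E \<inter> set ls))) * marg f v (set ls) \<le> \<beta> * f (set ls - E)"
proof -
  have "(real (length ls) - real (card (E \<inter> set ls))) * (marg f v (set ls) / \<beta>) \<le> f (set ls - E)"
  proof (rule remaining_value_ge)
    fix t assume t: "t < length ls"
    have "marg f v (set ls) \<le> marg f v (set (take t ls))"
      using assms set_take_subset[of t ls] by (intro marg_antimono) auto
    also have "\<dots> \<le> \<beta> * (f (set (take (Suc t) ls)) - f (set (take t ls)))"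
      using assms t unfolding iterative_list_def by blast
    finally show "marg f v (set ls) / \<beta> \<le> f (set (take (Suc t) ls)) - f (set (take t ls))"
      using beta by (simp add: field_simps)
  qed (use assms in auto)
  then show ?thesis using beta by (simp add: field_simps)
qed

text \<open>\<open>X\<close> is meant to be the surviving set. Putting the deleted part of
  \<open>ls\<close> back makes it contain all of \<open>ls\<close>, over which each element of
  \<open>N\<close> is worth at most \<open>\<beta> * f X / m\<close>, because at least
  \<open>m\<close> elements of \<open>ls\<close> survive inside \<open>X\<close>. The price of
  putting them back is the first summand, which is what lets the bound chain from one level to the
  next.\<close>

lemma gain_step:
  assumes ls: "iterative_list f \<beta> ls R" "distinct ls" "set ls - E \<subseteq> X" "set ls \<subseteq> V"
    and N: "N \<subseteq> R" "N \<subseteq> V" and X: "X \<subseteq> V"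
    and m: "0 < m" "m \<le> real (length ls) - real (card (E \<inter> set ls))"
  shows "f (X \<union> N) - f X \<le> (f (X \<union> (E \<inter> set ls)) - f X) + real (card N) * (\<beta> * f X / m)"
proof -
  let ?G = "E \<inter> set ls"
  have x: "f (set ls - E) \<le> f X" using ls X by (intro mono)
  have "f (set ls \<union> N) - f (set ls) \<le> real (card N) * (\<beta> * f X / m)"
  proof (rule gain_le_card)
    fix v assume "v \<in> N"
    then have v: "v \<in> R" "v \<in> V" using N by auto
    have "0 \<le> marg f v (set ls)" using mono[of "set ls" "insert v (set ls)"] v ls
      by (auto simp: marg_def)
    then have "m * marg f v (set ls)
        \<le> (real (length ls) - real (card (E \<inter> set ls))) * marg f v (set ls)"
      using m by (intro mult_right_mono)
    also have "\<dots> \<le> \<beta> * f (set ls - E)" by (rule marg_le_remaining[OF ls(1,2,4) v])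
    also have "\<dots> \<le> \<beta> * f X" using x beta by simp
    finally show "marg f v (set ls) \<le> \<beta> * f X / m" using m by (simp add: field_simps)
  qed (use ls N in auto)
  moreover have "f ((X \<union> ?G) \<union> N) - f (X \<union> ?G) \<le> f (set ls \<union> N) - f (set ls)"
    using ls N X by (intro gain_antimono) auto
  moreover have "f (X \<union> N) \<le> f ((X \<union> ?G) \<union> N)" using ls N X by (intro mono) auto
  ultimately show ?thesis by linarith
qed

text \<open>The usual greedy argument: all of \<open>O'\<close> stays among the candidates, so each
  step closes at least a fraction \<open>1 / (\<beta> * real q)\<close> of the gap to
  \<open>f O'\<close>.\<close>

lemma greedy_value_ge:
  assumes "iterative_list f \<beta> ls R" "set ls \<subseteq> V" "O' \<subseteq> R" "O' \<subseteq> V" "card O' \<le> q" "0 < q"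
  shows "(1 - exp (- (real (length ls) / (\<beta> * real q)))) * f O' \<le> f (set ls)"
proof -
  let ?y = "1 / (\<beta> * real q)"
  have bq: "1 \<le> \<beta> * real q" using beta assms(6) mult_mono[of 1 \<beta> 1 "real q"] by simp
  then have y: "0 \<le> 1 - ?y" by (simp add: field_simps)
  have "t \<le> length ls \<Longrightarrow> f O' - f (set (take t ls)) \<le> (1 - ?y) ^ t * f O'" for t
  proof (induction t)
    case 0
    then show ?case by (simp add: norm)
  next
    case (Suc t)
    let ?P = "set (take t ls)" and ?P' = "set (take (Suc t) ls)"
    let ?g = "f ?P' - f ?P"
    have PV: "?P \<subseteq> V" "?P' \<subseteq> V" using assms set_take_subset by fast+
    have g0: "0 \<le> ?g" using mono[of ?P ?P'] PV set_take_subset_set_take[of t "Suc t" ls] by simp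
    have "f O' \<le> f (?P \<union> O')" using PV assms by (intro mono) auto
    also have "f (?P \<union> O') - f ?P \<le> real (card O') * (\<beta> * ?g)"
      using assms Suc.prems PV unfolding iterative_list_def by (intro gain_le_card) auto
    also have "\<dots> \<le> real q * (\<beta> * ?g)" using assms g0 beta by (intro mult_right_mono) auto
    finally have "f O' - f ?P \<le> \<beta> * real q * ?g" by (simp add: algebra_simps)
    then have "(f O' - f ?P) * ?y \<le> ?g" using bq
      by (simp add: pos_divide_le_eq mult.commute[of ?g])
    then have "f O' - f ?P' \<le> (1 - ?y) * (f O' - f ?P)" by (simp add: algebra_simps)
    also have "\<dots> \<le> (1 - ?y) * ((1 - ?y) ^ t * f O')"
      using Suc y by (intro mult_left_mono) auto
    finally show ?case by simp
  qed
  from this[of "length ls"] have 1: "f O' - f (set ls) \<le> (1 - ?y) ^ length ls * f O'" by simp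
  have "(1 - ?y) ^ length ls \<le> exp (- ?y) ^ length ls"
    using y exp_ge_add_one_self[of "- ?y"] by (intro power_mono) auto
  also have "\<dots> = exp (- (real (length ls) / (\<beta> * real q)))"
    by (simp add: exp_of_nat_mult[symmetric])
  finally have "(1 - ?y) ^ length ls * f O' \<le> exp (- (real (length ls) / (\<beta> * real q))) * f O'"
    using nonneg[of O'] assms by (intro mult_right_mono) auto
  then show ?thesis using 1 by (simp add: algebra_simps)
qed

section \<open>The buckets\<close>

text \<open>The last claim is the pigeonhole principle: if each of the \<open>m\<close> buckets lost
  at least \<open>q\<close> elements, at least \<open>q * m\<close> would be deleted. Each bucket
  was chosen from a set containing \<open>V - Y\<close>, so its iterative property survives for the
  candidates left after the whole level.\<close>

lemma level_buckets:
  fixes i \<eta> m :: nat and X :: "'a set"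
  defines "n \<equiv> 2 ^ i * \<eta>" and "Y \<equiv> (pro_step V \<eta> A i ^^ m) X"
  assumes "X \<subseteq> V" "card X + m * n \<le> card V"
  shows "X \<subseteq> Y" "Y \<subseteq> V" "card Y = card X + m * n"
    "card (E \<inter> (Y - X)) < q * m \<Longrightarrow> \<exists>ls. set ls \<subseteq> Y - X \<and> distinct ls \<and> length ls = n
       \<and> card (E \<inter> set ls) < q \<and> iterative_list f \<beta> ls (V - Y)"
proof -
  have "X \<subseteq> Y \<and> Y \<subseteq> V \<and> card Y = card X + m * n \<and>
    (card (E \<inter> (Y - X)) < q * m \<longrightarrow> (\<exists>ls. set ls \<subseteq> Y - X \<and> distinct ls \<and> length ls = n
       \<and> card (E \<inter> set ls) < q \<and> iterative_list f \<beta> ls (V - Y)))"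
    using assms(4) unfolding Y_def
  proof (induction m)
    case 0
    then show ?case using assms by simp
  next
    case (Suc m)
    let ?Y = "(pro_step V \<eta> A i ^^ m) X"
    let ?ls = "A n (V - ?Y)"
    let ?Z = "?Y \<union> set ?ls"
    have Z: "(pro_step V \<eta> A i ^^ Suc m) X = ?Z" by (simp add: pro_step_def n_def)
    have IH: "X \<subseteq> ?Y" "?Y \<subseteq> V" "card ?Y = card X + m * n"
      "card (E \<inter> (?Y - X)) < q * m \<Longrightarrow> \<exists>ls. set ls \<subseteq> ?Y - X \<and> distinct ls \<and> length ls = n
         \<and> card (E \<inter> set ls) < q \<and> iterative_list f \<beta> ls (V - ?Y)"
      using Suc by auto
    have finY: "finite ?Y" using IH(2) fin finite_subset by blast
    have n: "n \<le> card (V - ?Y)" using IH Suc.prems finY by (simp add: card_Diff_subset)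
    note ls = subroutine_list[OF Diff_subset n] iterative_list_subroutine[OF Diff_subset n]
    have disj: "?Y \<inter> set ?ls = {}" using ls by auto
    have "card ?Z = card ?Y + card (set ?ls)" using disj finY by (intro card_Un_disjoint) auto
    then have card: "card ?Z = card X + Suc m * n" using IH ls by (simp add: distinct_card)
    have "\<exists>ls. set ls \<subseteq> ?Z - X \<and> distinct ls \<and> length ls = n
       \<and> card (E \<inter> set ls) < q \<and> iterative_list f \<beta> ls (V - ?Z)"
      if less: "card (E \<inter> (?Z - X)) < q * Suc m"
    \<comment> \<open>Either the newest bucket is lightly damaged, or it accounts for
      \<open>q\<close> deletions and fewer than \<open>q * m\<close> remain for the earlier
      ones.\<close>
    proof (cases "card (E \<inter> set ?ls) < q")
      case True
      have "iterative_list f \<beta> ?ls (V - ?Z)" by (rule iterative_list_subset[OF ls(4)]) auto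
      then show ?thesis using True ls IH by (intro exI[of _ ?ls]) auto
    next
      case False
      have "E \<inter> (?Z - X) = (E \<inter> (?Y - X)) \<union> (E \<inter> set ?ls)" using disj IH ls by auto
      then have "card (E \<inter> (?Z - X)) = card (E \<inter> (?Y - X)) + card (E \<inter> set ?ls)"
        using disj finY by (simp add: card_Un_disjoint disjoint_iff)
      then have "card (E \<inter> (?Y - X)) < q * m" using False less by simp
      then obtain l where l: "set l \<subseteq> ?Y - X" "distinct l" "length l = n"
        "card (E \<inter> set l) < q" "iterative_list f \<beta> l (V - ?Y)" using IH(4) by auto
      have "iterative_list f \<beta> l (V - ?Z)" by (rule iterative_list_subset[OF l(5)]) auto
      then show ?thesis using l by (intro exI[of _ l]) auto
    qed
    then show ?case unfolding Z using card IH ls by auto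
  qed
  then show "X \<subseteq> Y" "Y \<subseteq> V" "card Y = card X + m * n"
    "card (E \<inter> (Y - X)) < q * m \<Longrightarrow> \<exists>ls. set ls \<subseteq> Y - X \<and> distinct ls \<and> length ls = n
       \<and> card (E \<inter> set ls) < q \<and> iterative_list f \<beta> ls (V - Y)" by auto
qed

end

section \<open>Number and total size of the buckets\<close>

definition bucket_count :: "nat \<Rightarrow> nat \<Rightarrow> nat" where
  "bucket_count \<tau> i = nat \<lceil>real \<tau> / 2 ^ i\<rceil>"

text \<open>This is the state of the outer loop before level \<open>i\<close>, which permits
  induction on levels; the buckets of level \<open>i\<close> together form the difference of two
  consecutive states.\<close>

definition levels_upto :: "'a set \<Rightarrow> nat \<Rightarrow> nat \<Rightarrow> (nat \<Rightarrow> 'a set \<Rightarrow> 'a list) \<Rightarrow> nat \<Rightarrow> 'a set" where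
  "levels_upto V \<tau> \<eta> A i =
     fold (\<lambda>i S0. (pro_step V \<eta> A i ^^ bucket_count \<tau> i) S0) [0..<i] {}"

lemma levels_upto_0: "levels_upto V \<tau> \<eta> A 0 = {}"
  by (simp add: levels_upto_def)

lemma levels_upto_Suc:
  "levels_upto V \<tau> \<eta> A (Suc i) = (pro_step V \<eta> A i ^^ bucket_count \<tau> i) (levels_upto V \<tau> \<eta> A i)"
  by (simp add: levels_upto_def)

lemma pro_S0_eq: "pro_S0 V \<tau> \<eta> A = levels_upto V \<tau> \<eta> A (Suc (nat \<lceil>log 2 (real \<tau>)\<rceil>))"
  by (simp add: pro_S0_def levels_upto_def bucket_count_def)

text \<open>The lower bound feeds the pigeonhole at level \<open>i\<close>, with fewer than
  \<open>2 ^ i\<close> losses in some bucket; the upper bound controls the size of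
  \<open>S0\<close>.\<close>

lemma bucket_count_bounds:
  "\<tau> \<le> 2 ^ i * bucket_count \<tau> i" "real (bucket_count \<tau> i * 2 ^ i) \<le> real \<tau> + 2 ^ i"
proof -
  have eq: "real (bucket_count \<tau> i) = of_int \<lceil>real \<tau> / 2 ^ i\<rceil>"
    by (simp add: bucket_count_def of_nat_nat)
  have 1: "real \<tau> / 2 ^ i \<le> real (bucket_count \<tau> i)" unfolding eq by (rule le_of_int_ceiling)
  have 2: "real (bucket_count \<tau> i) \<le> real \<tau> / 2 ^ i + 1" unfolding eq by linarith
  from 1 have "real \<tau> \<le> real (2 ^ i * bucket_count \<tau> i)" by (simp add: field_simps)
  then show "\<tau> \<le> 2 ^ i * bucket_count \<tau> i" by (simp only: of_nat_le_iff)
  show "real (bucket_count \<tau> i * 2 ^ i) \<le> real \<tau> + 2 ^ i" using 2 by (simp add: field_simps)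
qed

lemma total_size_le:
  "real (\<Sum>j<n. bucket_count \<tau> j * (2 ^ j * \<eta>)) \<le> real \<eta> * (real n * real \<tau> + 2 ^ n)"
proof -
  have "real (\<Sum>j<n. bucket_count \<tau> j * (2 ^ j * \<eta>))
      = real \<eta> * (\<Sum>j<n. real (bucket_count \<tau> j * 2 ^ j))"
    by (simp add: sum_distrib_left mult_ac)
  also have "\<dots> \<le> real \<eta> * (\<Sum>j<n. real \<tau> + 2 ^ j)"
    by (intro mult_left_mono sum_mono bucket_count_bounds) auto
  also have "(\<Sum>j<n. real \<tau> + 2 ^ j) = real n * real \<tau> + (2 ^ n - 1)"
    by (induction n) (auto simp: algebra_simps)
  also have "real \<eta> * \<dots> \<le> real \<eta> * (real n * real \<tau> + 2 ^ n)"
    by (intro mult_left_mono) auto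
  finally show ?thesis .
qed

lemma ceiling_log_bounds:
  fixes \<tau> :: nat
  assumes "2 \<le> \<tau>"
  defines "L \<equiv> nat \<lceil>log 2 (real \<tau>)\<rceil>"
  shows "1 \<le> L" "\<tau> \<le> 2 ^ L" "2 ^ L \<le> 2 * real \<tau>" "real L \<le> log 2 \<tau> + 1"
    "real L = of_int \<lceil>log 2 (real \<tau>)\<rceil>"
proof -
  have log: "1 \<le> log 2 (real \<tau>)" using assms by (simp add: le_log_iff)
  then show L: "real L = of_int \<lceil>log 2 (real \<tau>)\<rceil>" unfolding L_def
    by (intro of_nat_nat) linarith
  then have up: "log 2 \<tau> \<le> real L" by simp
  then show "1 \<le> L" using log by linarith
  show lo: "real L \<le> log 2 \<tau> + 1" using L by linarith
  have "real \<tau> = 2 powr log 2 \<tau>" using assms by simp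
  also have "\<dots> \<le> 2 powr real L" using up by simp
  also have "\<dots> = real (2 ^ L)" by (simp add: powr_realpow)
  finally show "\<tau> \<le> 2 ^ L" by (simp only: of_nat_le_iff)
  have "2 ^ L = 2 powr real L" by (simp add: powr_realpow)
  also have "\<dots> \<le> 2 powr (log 2 \<tau> + 1)" using lo by simp
  also have "\<dots> = 2 * real \<tau>" using assms by (simp add: powr_add)
  finally show "2 ^ L \<le> 2 * real \<tau>" .
qed

section \<open>Propagation of damage through the levels\<close>

context iterative_subroutine
begin

lemma levels_upto_props:
  assumes "(\<Sum>j<i. bucket_count \<tau> j * (2 ^ j * \<eta>)) \<le> card V"
  shows "levels_upto V \<tau> \<eta> A i \<subseteq> V \<and>
    card (levels_upto V \<tau> \<eta> A i) = (\<Sum>j<i. bucket_count \<tau> j * (2 ^ j * \<eta>))"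
  using assms
proof (induction i)
  case 0
  then show ?case by (simp add: levels_upto_0)
next
  case (Suc i)
  then have IH: "levels_upto V \<tau> \<eta> A i \<subseteq> V"
    "card (levels_upto V \<tau> \<eta> A i) = (\<Sum>j<i. bucket_count \<tau> j * (2 ^ j * \<eta>))" by auto
  have "card (levels_upto V \<tau> \<eta> A i) + bucket_count \<tau> i * (2 ^ i * \<eta>) \<le> card V"
    using Suc.prems IH by simp
  from level_buckets(2,3)[OF IH(1) this] show ?case using IH(2) by (simp add: levels_upto_Suc)
qed

text \<open>The chosen bucket of level \<open>i\<close> keeps at least
  \<open>2 ^ i * (real \<eta> - 1)\<close> elements, while the one chosen a level higher loses at
  most \<open>2 ^ Suc i\<close>. The powers of two cancel up to a factor 2 in
  \<open>gain_step\<close>, so every level adds the same amount and the total loss grows only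
  linearly.\<close>

lemma damaged_bucket:
  fixes \<eta> :: nat
  assumes size: "(\<Sum>j<Suc n. bucket_count \<tau> j * (2 ^ j * \<eta>)) \<le> card V"
    and E: "finite E" "card (E \<inter> levels_upto V \<tau> \<eta> A (Suc n)) < \<tau>" and eta: "2 \<le> \<eta>"
    and X: "X \<subseteq> V" "levels_upto V \<tau> \<eta> A (Suc n) - E \<subseteq> X"
  shows "i \<le> n \<Longrightarrow> \<exists>ls. set ls \<subseteq> levels_upto V \<tau> \<eta> A (Suc i) - levels_upto V \<tau> \<eta> A i
    \<and> distinct ls \<and> length ls = 2 ^ i * \<eta> \<and> card (E \<inter> set ls) < 2 ^ i
    \<and> iterative_list f \<beta> ls (V - levels_upto V \<tau> \<eta> A (Suc i))
    \<and> f (X \<union> (E \<inter> set ls)) - f X \<le> real i * (2 * \<beta> / (real \<eta> - 1) * f X)"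
proof -
  let ?T = "levels_upto V \<tau> \<eta> A"
  have size': "(\<Sum>j<i. bucket_count \<tau> j * (2 ^ j * \<eta>)) \<le> card V" if "i \<le> Suc n" for i
    by (rule order_trans[OF sum_mono2 size]) (use that in auto)
  have level: "?T i \<subseteq> V \<and> ?T i \<subseteq> ?T (Suc i) \<and> (card (E \<inter> (?T (Suc i) - ?T i)) < \<tau> \<longrightarrow>
      (\<exists>ls. set ls \<subseteq> ?T (Suc i) - ?T i \<and> distinct ls \<and> length ls = 2 ^ i * \<eta>
        \<and> card (E \<inter> set ls) < 2 ^ i \<and> iterative_list f \<beta> ls (V - ?T (Suc i))))"
    if "i \<le> n" for i
  proof -
    have 1: "?T i \<subseteq> V" using levels_upto_props size' that by auto
    have 2: "card (?T i) + bucket_count \<tau> i * (2 ^ i * \<eta>) \<le> card V"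
      using levels_upto_props[OF size'[of i]] size'[of "Suc i"] that by simp
    have "\<tau> \<le> 2 ^ i * bucket_count \<tau> i" by (rule bucket_count_bounds)
    then show ?thesis
      using 1 level_buckets(1)[OF 1 2] level_buckets(4)[OF 1 2, of E "2 ^ i"]
      unfolding levels_upto_Suc by (meson order_less_le_trans)
  qed
  have sub: "?T i \<subseteq> ?T (Suc n)" if "i \<le> Suc n" for i
    using that
  proof (induction rule: inc_induct)
    case (step m)
    then show ?case using level[of m] by fastforce
  qed simp
  have bucket: "\<exists>ls. set ls \<subseteq> ?T (Suc i) - ?T i \<and> distinct ls \<and> length ls = 2 ^ i * \<eta>
      \<and> card (E \<inter> set ls) < 2 ^ i \<and> iterative_list f \<beta> ls (V - ?T (Suc i))"
    if "i \<le> n" for i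
  proof -
    have "E \<inter> (?T (Suc i) - ?T i) \<subseteq> E \<inter> ?T (Suc n)" using sub[of "Suc i"] that by auto
    then have "card (E \<inter> (?T (Suc i) - ?T i)) \<le> card (E \<inter> ?T (Suc n))"
      using E by (intro card_mono) auto
    then show ?thesis using level[OF that] E by auto
  qed
  show "i \<le> n \<Longrightarrow> ?thesis"
  proof (induction i)
    case 0
    obtain ls where ls: "set ls \<subseteq> ?T (Suc 0) - ?T 0" "distinct ls" "length ls = 2 ^ 0 * \<eta>"
      "card (E \<inter> set ls) < 2 ^ 0" "iterative_list f \<beta> ls (V - ?T (Suc 0))"
      using bucket[of 0] by auto
    \<comment> \<open>At level 0 fewer than \<open>2 ^ 0\<close> losses means an intact bucket, so
      the chain starts with no loss.\<close>
    have "E \<inter> set ls = {}" using ls(4) by simp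
    then have "f (X \<union> (E \<inter> set ls)) - f X \<le> real 0 * (2 * \<beta> / (real \<eta> - 1) * f X)" by simp
    then show ?case using ls by blast
  next
    case (Suc i)
    then obtain ls where ls: "set ls \<subseteq> ?T (Suc i) - ?T i" "distinct ls" "length ls = 2 ^ i * \<eta>"
      "card (E \<inter> set ls) < 2 ^ i" "iterative_list f \<beta> ls (V - ?T (Suc i))"
      "f (X \<union> (E \<inter> set ls)) - f X \<le> real i * (2 * \<beta> / (real \<eta> - 1) * f X)"
      by auto
    obtain ls' where ls': "set ls' \<subseteq> ?T (Suc (Suc i)) - ?T (Suc i)" "distinct ls'"
      "length ls' = 2 ^ Suc i * \<eta>" "card (E \<inter> set ls') < 2 ^ Suc i"
      "iterative_list f \<beta> ls' (V - ?T (Suc (Suc i)))"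
      using bucket[of "Suc i"] Suc.prems by auto
    have TV: "?T (Suc n) \<subseteq> V" using levels_upto_props[OF size] by simp
    have subs: "set ls \<subseteq> ?T (Suc n)" "set ls' \<subseteq> ?T (Suc n)"
      using ls ls' sub[of "Suc i"] sub[of "Suc (Suc i)"] Suc.prems by auto
    have x0: "0 \<le> \<beta> * f X / (2 ^ i * (real \<eta> - 1))" using beta nonneg[OF X(1)] eta by simp
    have g: "real (card (E \<inter> set ls)) \<le> 2 ^ i" "real (card (E \<inter> set ls')) \<le> 2 ^ Suc i"
      using ls(4) ls'(4) by (simp_all add: of_nat_less_numeral_power_cancel_iff order_less_imp_le
          of_nat_le_numeral_power_cancel_iff flip: power_Suc)
    have "f (X \<union> (E \<inter> set ls')) - f X \<le> (f (X \<union> (E \<inter> set ls)) - f X)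
        + real (card (E \<inter> set ls')) * (\<beta> * f X / (2 ^ i * (real \<eta> - 1)))"
    proof (rule gain_step[OF ls(5,2)])
      show "set ls - E \<subseteq> X" "set ls \<subseteq> V" using subs X TV by auto
      \<comment> \<open>The next bucket lies outside \<open>?T (Suc i)\<close>, so its elements were
        still candidates when \<open>ls\<close> was built.\<close>
      show "E \<inter> set ls' \<subseteq> V - ?T (Suc i)" "E \<inter> set ls' \<subseteq> V" using subs TV ls' by auto
      show "0 < 2 ^ i * (real \<eta> - 1)" using eta by simp
      show "2 ^ i * (real \<eta> - 1) \<le> real (length ls) - real (card (E \<inter> set ls))"
        using g ls(3) by (simp add: algebra_simps)
    qed (use X in auto)
    also have "\<dots> \<le> real i * (2 * \<beta> / (real \<eta> - 1) * f X)
        + 2 ^ Suc i * (\<beta> * f X / (2 ^ i * (real \<eta> - 1)))"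
      using ls(6) g x0 by (intro add_mono mult_right_mono) auto
    also have "\<dots> = real (Suc i) * (2 * \<beta> / (real \<eta> - 1) * f X)"
      by (simp add: add_divide_distrib distrib_right)
    finally show ?case using ls' by blast
  qed
qed

text \<open>Restoring \<open>E \<inter> S1\<close> to the survivors recovers all of
  \<open>S1\<close>, so a bound on that gain by a multiple of the surviving value bounds
  \<open>f S1\<close> as well.\<close>

lemma remaining_ge_S1:
  fixes \<tau> \<eta> :: nat
  defines "L \<equiv> nat \<lceil>log 2 (real \<tau>)\<rceil>"
  defines "S0 \<equiv> pro_S0 V \<tau> \<eta> A"
  assumes size: "(\<Sum>j<Suc L. bucket_count \<tau> j * (2 ^ j * \<eta>)) \<le> card V"
    and tau: "2 \<le> \<tau>" and eta: "4 \<le> \<eta>"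
    and S1: "S1 \<subseteq> V - S0" and E: "card E \<le> \<tau>" "finite E"
  shows "real \<eta> / (5 * \<beta> ^ 3 * real L + real \<eta>) * f S1 \<le> f ((S0 \<union> S1) - E)"
proof -
  let ?T = "levels_upto V \<tau> \<eta> A" and ?X = "(S0 \<union> S1) - E" and ?E1 = "E \<inter> S1"
  note L = ceiling_log_bounds[OF tau, folded L_def]
  have S0: "S0 = ?T (Suc L)" by (simp add: S0_def pro_S0_eq L_def)
  have S0V: "S0 \<subseteq> V" unfolding S0 using levels_upto_props[OF size] by simp
  have XV: "?X \<subseteq> V" using S0V S1 by auto
  have b3: "\<beta> \<le> \<beta> ^ 3" using beta self_le_power[of \<beta> 3] by simp
  have pos: "0 \<le> \<beta> ^ 3 * real L" using beta by simp
  have le: "f S1 \<le> f (?X \<union> ?E1)" using S0V S1 by (intro mono) auto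
  have x0: "0 \<le> f ?X" by (rule nonneg[OF XV])
  have E1: "f (?X \<union> ?E1) - f ?X \<le> 5 * \<beta> ^ 3 * real L / real \<eta> * f ?X"
  proof (cases "?E1 = {}")
    case True
    then show ?thesis using x0 beta by simp
  next
    case False
    \<comment> \<open>A deletion spent on \<open>S1\<close> misses \<open>S0\<close>; this gives the
      strict inequality that the pigeonhole requires.\<close>
    have "E \<inter> S0 \<subset> E" using False S1 by auto
    then have "card (E \<inter> S0) < \<tau>" using E psubset_card_mono[of E "E \<inter> S0"] by linarith
    then obtain ls where ls: "set ls \<subseteq> ?T (Suc L) - ?T L" "distinct ls" "length ls = 2 ^ L * \<eta>"
      "card (E \<inter> set ls) < 2 ^ L" "iterative_list f \<beta> ls (V - ?T (Suc L))"
      "f (?X \<union> (E \<inter> set ls)) - f ?X \<le> real L * (2 * \<beta> / (real \<eta> - 1) * f ?X)"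
      using damaged_bucket[OF size E(2) _ _ XV, of L] eta unfolding S0 by auto
    have g: "real (card (E \<inter> set ls)) \<le> 2 ^ L"
      using ls(4) by (simp add: of_nat_le_numeral_power_cancel_iff)
    \<comment> \<open>The top level is chosen so that \<open>\<tau> \<le> 2 ^ L\<close>: one of its
      buckets can pay for every deletion in \<open>S1\<close>, and this last payment is the
      \<open>+ 1\<close> in \<open>2 * real L + 1\<close>.\<close>
    have "card ?E1 \<le> 2 ^ L" using card_mono[OF E(2), of ?E1] E L by simp
    then have e1: "real (card ?E1) \<le> 2 ^ L" by (simp add: of_nat_le_numeral_power_cancel_iff)
    have "f (?X \<union> ?E1) - f ?X \<le> (f (?X \<union> (E \<inter> set ls)) - f ?X)
        + real (card ?E1) * (\<beta> * f ?X / (2 ^ L * (real \<eta> - 1)))"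
    proof (rule gain_step[OF ls(5,2)])
      show "set ls - E \<subseteq> ?X" "set ls \<subseteq> V" using ls S0 S0V by auto
      show "?E1 \<subseteq> V - ?T (Suc L)" "?E1 \<subseteq> V" using S1 S0 by auto
      show "0 < 2 ^ L * (real \<eta> - 1)" using eta by simp
      show "2 ^ L * (real \<eta> - 1) \<le> real (length ls) - real (card (E \<inter> set ls))"
        using g ls(3) by (simp add: algebra_simps)
    qed (rule XV)
    also have "\<dots> \<le> real L * (2 * \<beta> / (real \<eta> - 1) * f ?X)
        + 2 ^ L * (\<beta> * f ?X / (2 ^ L * (real \<eta> - 1)))"
      using ls(6) e1 x0 beta eta by (intro add_mono mult_right_mono) auto
    also have "\<dots> = (2 * real L + 1) * (\<beta> / (real \<eta> - 1) * f ?X)"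
      by (simp add: add_divide_distrib distrib_right)
    \<comment> \<open>Rounding to the stated constant: \<open>1 \<le> L\<close> and
      \<open>\<beta> \<le> \<beta> ^ 3\<close> here, then
      \<open>3 / (real \<eta> - 1) \<le> 5 / real \<eta>\<close> from
      \<open>4 \<le> \<eta>\<close>.\<close>
    also have "\<dots> \<le> (3 * real L) * (\<beta> ^ 3 / (real \<eta> - 1) * f ?X)"
      using L(1) x0 b3 beta eta by (intro mult_mono divide_right_mono) auto
    also have "\<dots> = 3 / (real \<eta> - 1) * (\<beta> ^ 3 * real L * f ?X)" by simp
    also have "\<dots> \<le> 5 / real \<eta> * (\<beta> ^ 3 * real L * f ?X)"
      using mult_nonneg_nonneg[OF pos x0] eta by (intro mult_right_mono) (auto simp: field_simps)
    also have "\<dots> = 5 * \<beta> ^ 3 * real L / real \<eta> * f ?X" by simp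
    finally show ?thesis .
  qed
  have "f S1 \<le> f ?X + 5 * \<beta> ^ 3 * real L / real \<eta> * f ?X" using le E1 by linarith
  also have "\<dots> = (5 * \<beta> ^ 3 * real L + real \<eta>) / real \<eta> * f ?X"
    using eta by (simp add: field_simps)
  finally show ?thesis using pos eta
    by (simp add: field_simps add_pos_nonneg pos_divide_le_eq)
qed

end

section \<open>Arithmetic consequences of the parameter hypotheses\<close>

lemma parameter_bounds:
  fixes k \<tau> \<eta> :: nat
  assumes "\<eta> > 0" "real \<eta> \<ge> 4 * (log 2 (real k) + 1)" "2 \<le> \<tau>"
    and "real \<tau> \<le> real k / (3 * real \<eta> * (log 2 (real k) + 2))"
  shows "1 \<le> k" "0 \<le> log 2 (real k)" "4 \<le> \<eta>" "\<tau> < k"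
    "3 * real \<eta> * real \<tau> * (log 2 (real k) + 2) \<le> real k"
proof -
  \<comment> \<open>For \<open>k = 0\<close> the upper bound on \<open>\<tau>\<close> would be
    0.\<close>
  show k: "1 \<le> k" using assms by (cases "k = 0") auto
  then show l: "0 \<le> log 2 (real k)" by simp
  then show eta: "4 \<le> \<eta>" using assms by simp
  have "0 < 3 * real \<eta> * (log 2 (real k) + 2)" using l eta by simp
  then show main: "3 * real \<eta> * real \<tau> * (log 2 (real k) + 2) \<le> real k"
    using assms(4) by (simp add: pos_le_divide_eq mult_ac)
  have "1 * 2 \<le> (3 * real \<eta>) * (log 2 (real k) + 2)" using l eta by (intro mult_mono) auto
  then have "2 * real \<tau> \<le> 3 * real \<eta> * (log 2 (real k) + 2) * real \<tau>"
    by (intro mult_right_mono) auto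
  then have "2 * real \<tau> \<le> real k" using main by (simp add: mult_ac)
  then show "\<tau> < k" using assms(3) by linarith
qed

text \<open>The 6 splits as 2 + 4: there are at most \<open>log 2 (real k) + 2\<close> levels, and
  the geometric sum contributes \<open>2 ^ Suc L \<le> 4 * real \<tau>\<close>.\<close>

lemma total_bucket_size_le:
  fixes k \<tau> \<eta> :: nat
  assumes "2 \<le> \<tau>" "\<tau> < k"
  shows "real (\<Sum>j<Suc (nat \<lceil>log 2 (real \<tau>)\<rceil>). bucket_count \<tau> j * (2 ^ j * \<eta>))
    \<le> real \<eta> * real \<tau> * (log 2 (real k) + 6)"
proof -
  define L where "L = nat \<lceil>log 2 (real \<tau>)\<rceil>"
  note L = ceiling_log_bounds[OF assms(1), folded L_def]
  have "real L \<le> log 2 (real k) + 1" using L(4) assms log_le_cancel_iff[of 2 "real \<tau>" "real k"]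
    by linarith
  then have "real (Suc L) * real \<tau> \<le> (log 2 (real k) + 2) * real \<tau>"
    by (intro mult_right_mono) auto
  then have "real (Suc L) * real \<tau> + 2 ^ Suc L \<le> real \<tau> * (log 2 (real k) + 6)"
    using L(3) by (simp add: algebra_simps)
  then have "real \<eta> * (real (Suc L) * real \<tau> + 2 ^ Suc L)
      \<le> real \<eta> * (real \<tau> * (log 2 (real k) + 6))" by (intro mult_left_mono) auto
  then show ?thesis using total_size_le[of \<tau> \<eta> "Suc L"] unfolding L_def by (simp add: mult.assoc)
qed

section \<open>The approximation guarantee\<close>

lemma robust_val_attained:
  assumes "finite S"
  obtains E where "E \<subseteq> S" "card E \<le> \<tau>" "robust_val f \<tau> S = f (S - E)"
proof -
  let ?M = "(\<lambda>E. f (S - E)) ` {E. E \<subseteq> S \<and> card E \<le> \<tau>}"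
  have "finite ?M" using assms by simp
  moreover have "{} \<in> {E. E \<subseteq> S \<and> card E \<le> \<tau>}" by simp
  then have "?M \<noteq> {}" by blast
  ultimately have "Min ?M \<in> ?M" by (rule Min_in)
  then show ?thesis using that unfolding robust_val_def by auto
qed

lemma robust_val_le:
  "finite S \<Longrightarrow> E \<subseteq> S \<Longrightarrow> card E \<le> \<tau> \<Longrightarrow> robust_val f \<tau> S \<le> f (S - E)"
  unfolding robust_val_def by (intro Min_le) auto

lemma opt_robust_val_attained:
  assumes "finite V" "k \<le> card V"
  obtains S where "S \<subseteq> V" "card S = k" "opt_robust_val f V k \<tau> = robust_val f \<tau> S"
proof -
  let ?M = "robust_val f \<tau> ` {S. S \<subseteq> V \<and> card S = k}"
  obtain S where "S \<subseteq> V" "card S = k" using assms by (meson obtain_subset_with_card_n)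
  then have "?M \<noteq> {}" by blast
  moreover have "finite ?M" using assms by simp
  ultimately have "Max ?M \<in> ?M" by (intro Max_in)
  then show ?thesis using that unfolding opt_robust_val_def by auto
qed

text \<open>For an optimal \<open>S\<close>, enlarge \<open>S \<inter> E\<close> inside
  \<open>S\<close> to a set of exactly \<open>\<tau>\<close> elements. Removing it is an admissible
  deletion, and what is left avoids \<open>E\<close> and has \<open>k - \<tau>\<close> elements, the
  source of \<open>k - \<tau>\<close> in the exponent.\<close>

lemma opt_robust_val_le:
  assumes "finite V" "k \<le> card V" "\<tau> \<le> k" "finite E" "card E \<le> \<tau>"
  obtains O' where "O' \<subseteq> V - E" "card O' = k - \<tau>" "opt_robust_val f V k \<tau> \<le> f O'"
proof -
  obtain S where S: "S \<subseteq> V" "card S = k" "opt_robust_val f V k \<tau> = robust_val f \<tau> S"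
    using opt_robust_val_attained[OF assms(1,2)] by blast
  have finS: "finite S" using S assms finite_subset by blast
  have "card (S \<inter> E) \<le> \<tau>" using card_mono[of E "S \<inter> E"] assms by auto
  then obtain E' where E': "S \<inter> E \<subseteq> E'" "E' \<subseteq> S" "card E' = \<tau>"
    using exists_subset_between[of "S \<inter> E" \<tau> S] assms S finS by auto
  show ?thesis
  proof (rule that)
    show "S - E' \<subseteq> V - E" using S E' by auto
    show "card (S - E') = k - \<tau>"
      using E' S finS by (simp add: card_Diff_subset finite_subset)
    show "opt_robust_val f V k \<tau> \<le> f (S - E')"
      using robust_val_le[OF finS E'(2), of \<tau> f] E' S by simp
  qed
qed

context iterative_subroutine
begin

text \<open>The size bound on \<open>S0\<close> is exported because the limit of the constant
  depends on it.\<close>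

lemma PRo_guarantee:
  assumes k: "k \<le> card V" and eta0: "\<eta> > 0" "real \<eta> \<ge> 4 * (log 2 (real k) + 1)"
    and tau: "2 \<le> \<tau>" "real \<tau> \<le> real k / (3 * real \<eta> * (log 2 (real k) + 2))"
  defines "c \<equiv> pro_constant \<beta> k \<tau> \<eta> (card (pro_S0 V \<tau> \<eta> A))"
  shows "real (card (pro_S0 V \<tau> \<eta> A)) \<le> real \<eta> * real \<tau> * (log 2 (real k) + 6)"
    and "card (PRo V k \<tau> \<eta> A) = k"
    and "c / (1 + c) * opt_robust_val f V k \<tau> \<le> robust_val f \<tau> (PRo V k \<tau> \<eta> A)"
proof -
  note par = parameter_bounds[OF eta0 tau]
  define L where "L = nat \<lceil>log 2 (real \<tau>)\<rceil>"
  define S0 where "S0 = pro_S0 V \<tau> \<eta> A"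
  define ls where "ls = A (k - card S0) (V - S0)"
  let ?N = "\<Sum>j<Suc L. bucket_count \<tau> j * (2 ^ j * \<eta>)"
  have N: "real ?N \<le> real \<eta> * real \<tau> * (log 2 (real k) + 6)"
    using total_bucket_size_le[OF tau(1) par(4), of \<eta>] unfolding L_def .
  \<comment> \<open>\<open>log 2 (real k) + 6 \<le> 3 * (log 2 (real k) + 2)\<close> matches the
    factor 3 in the hypothesis on \<open>\<tau>\<close>, so \<open>S0\<close> fits into the
    budget.\<close>
  also have "\<dots> \<le> real \<eta> * real \<tau> * (3 * (log 2 (real k) + 2))"
    using par by (intro mult_left_mono) auto
  also have "\<dots> \<le> real k" using par(5) by (simp add: mult_ac)
  finally have Nk: "?N \<le> k" by (simp only: of_nat_le_iff)
  have S0: "S0 \<subseteq> V" "card S0 = ?N"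
    using levels_upto_props[of \<tau> \<eta> "Suc L"] Nk k unfolding S0_def pro_S0_eq L_def by auto
  then show "real (card (pro_S0 V \<tau> \<eta> A)) \<le> real \<eta> * real \<tau> * (log 2 (real k) + 6)"
    using N S0_def by simp
  have finS0: "finite S0" using S0 fin finite_subset by blast
  have le: "k - card S0 \<le> card (V - S0)" using S0 finS0 k by (simp add: card_Diff_subset)
  note ls = subroutine_list[OF Diff_subset le, folded ls_def]
    iterative_list_subroutine[OF Diff_subset le, folded ls_def]
  have S: "PRo V k \<tau> \<eta> A = S0 \<union> set ls"
    by (simp add: PRo_def pro_S1_def Let_def S0_def ls_def)
  have "card (S0 \<union> set ls) = card S0 + card (set ls)"
    using finS0 ls by (intro card_Un_disjoint) auto
  then show "card (PRo V k \<tau> \<eta> A) = k" unfolding S using ls S0 Nk by (simp add: distinct_card)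
  obtain E where E: "E \<subseteq> S0 \<union> set ls" "card E \<le> \<tau>"
    "robust_val f \<tau> (S0 \<union> set ls) = f (S0 \<union> set ls - E)"
    using robust_val_attained[of "S0 \<union> set ls" \<tau> f] finS0 by auto
  have finE: "finite E" using E(1) finS0 finite_subset by blast
  let ?x = "f (S0 \<union> set ls - E)"
  obtain O' where O': "O' \<subseteq> V - E" "card O' = k - \<tau>" "opt_robust_val f V k \<tau> \<le> f O'"
    using opt_robust_val_le[OF fin k _ finE E(2), of f] par(4) by auto
  define \<mu> where "\<mu> = real \<eta> / (5 * \<beta> ^ 3 * real L + real \<eta>)"
  define \<alpha> where "\<alpha> = 1 - exp (- (real (k - card S0) / (\<beta> * real (k - \<tau>))))"
  \<comment> \<open>Since \<open>card S0 \<le> k\<close> and \<open>\<tau> < k\<close>, the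
    natural-number differences agree with the real ones.\<close>
  have c: "c = \<mu> * \<alpha>"
    using par(4) S0 Nk ceiling_log_bounds(5)[OF tau(1)]
    unfolding c_def pro_constant_def \<mu>_def \<alpha>_def L_def S0_def[symmetric]
    by (simp add: of_nat_diff minus_divide_left)
  have \<mu>: "0 \<le> \<mu>" using beta unfolding \<mu>_def by simp
  have \<alpha>: "0 \<le> \<alpha>" "\<alpha> \<le> 1" using beta unfolding \<alpha>_def by simp_all
  have "\<mu> * f (set ls) \<le> ?x"
    using remaining_ge_S1[OF _ tau(1) par(3), of "set ls" E] ls(3) E finE Nk k
    unfolding \<mu>_def L_def S0_def by simp
  have finO: "finite O'" using O' fin finite_subset by blast
  have "\<alpha> * f (O' - S0) \<le> f (set ls)"
    unfolding \<alpha>_def ls(1)[symmetric]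
  proof (rule greedy_value_ge[OF ls(4)])
    show "card (O' - S0) \<le> k - \<tau>" using card_mono[OF finO, of "O' - S0"] O' by auto
  qed (use ls O' par in auto)
  \<comment> \<open>\<open>O'\<close> avoids \<open>E\<close>, so its part inside \<open>S0\<close>
    survives and is worth at most \<open>?x\<close>.\<close>
  moreover have "f O' - ?x \<le> f (O' - S0)"
  proof -
    have sub: "O' - S0 \<subseteq> V" "S0 - E \<subseteq> V" using O' S0 by auto
    have "f O' \<le> f ((S0 - E) \<union> (O' - S0))" using O' sub by (intro mono) auto
    also have "\<dots> \<le> f (S0 - E) + f (O' - S0)"
      using gain_antimono[of "{}" "S0 - E" "O' - S0"] sub norm by simp
    also have "f (S0 - E) \<le> ?x" using S0 ls by (intro mono) auto
    finally show ?thesis by simp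
  qed
  ultimately have "\<alpha> * (opt_robust_val f V k \<tau> - ?x) \<le> f (set ls)"
    using O'(3) \<alpha>(1) by (meson diff_right_mono mult_left_mono order_trans)
  then have "\<mu> * (\<alpha> * (opt_robust_val f V k \<tau> - ?x)) \<le> ?x"
    using \<mu> \<open>\<mu> * f (set ls) \<le> ?x\<close> by (meson mult_left_mono order_trans)
  then have "c * opt_robust_val f V k \<tau> \<le> (1 + c) * ?x" by (simp add: c algebra_simps)
  moreover have "0 < 1 + c" using \<mu> \<alpha> by (simp add: c add_pos_nonneg)
  ultimately show "c / (1 + c) * opt_robust_val f V k \<tau> \<le> robust_val f \<tau> (PRo V k \<tau> \<eta> A)"
    unfolding S E(3) by (simp add: pos_divide_le_eq mult.commute)
qed

end

lemma iterative_subroutineI: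
  assumes "finite V" "sf_normalized f" "sf_monotone V f" "sf_submodular V f"
    "valid_subroutine V A" "beta_iterative V f A \<beta>" "1 \<le> \<beta>"
  shows "iterative_subroutine V f A \<beta>"
  using assms unfolding sf_normalized_def sf_monotone_def sf_submodular_def
  by unfold_locales auto

section \<open>Asymptotics and numerical constants\<close>

text \<open>Three ratios vanish:
  \<open>\<lceil>log 2 (real (\<tau> k))\<rceil> / real (\<eta> k)\<close> because \<eta> dominates
  the squared logarithm, and \<open>s k / k\<close> and \<open>\<tau> k / k\<close> by the little-o
  hypothesis. Here \<open>s\<close> stands for the size of \<open>S0\<close>.\<close>

lemma pro_constant_tendsto:
  fixes \<tau> \<eta> s :: "nat \<Rightarrow> nat"
  assumes beta: "1 \<le> \<beta>"
    and par: "\<forall>\<^sub>F k in sequentially. \<eta> k > 0 \<and> real (\<eta> k) \<ge> 4 * (log 2 (real k) + 1)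
      \<and> 2 \<le> \<tau> k \<and> real (\<tau> k) \<le> real k / (3 * real (\<eta> k) * (log 2 (real k) + 2))
      \<and> real (\<eta> k) \<ge> (log 2 (real k))\<^sup>2"
    and s: "\<forall>\<^sub>F k in sequentially. real (s k) \<le> real (\<eta> k) * real (\<tau> k) * (log 2 (real k) + 6)"
    and small: "(\<lambda>k. real (\<tau> k)) \<in> o(\<lambda>k. real k / (real (\<eta> k) * log 2 (real k)))"
  shows "(\<lambda>k. pro_constant \<beta> k (\<tau> k) (\<eta> k) (s k)) \<longlonglongrightarrow> 1 - exp (- 1 / \<beta>)"
proof -
  have log_inf: "filterlim (\<lambda>k::nat. log 2 (real k)) at_top sequentially"
  proof -
    have "filterlim (\<lambda>k::nat. 1 / ln 2 * ln (real k)) at_top sequentially"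
      by (intro filterlim_tendsto_pos_mult_at_top[OF tendsto_const]
          filterlim_compose[OF ln_at_top filterlim_real_sequentially]) auto
    then show ?thesis by (simp add: log_def)
  qed
  have log1: "\<forall>\<^sub>F k in sequentially. 1 \<le> log 2 (real k)"
    using log_inf by (simp add: filterlim_at_top)
  have log_inv: "(\<lambda>k::nat. 2 / log 2 (real k)) \<longlonglongrightarrow> 0"
    by (rule tendsto_divide_0[OF tendsto_const filterlim_at_top_imp_at_infinity[OF log_inf]])
  let ?r = "\<lambda>k. of_int \<lceil>log 2 (real (\<tau> k))\<rceil> / real (\<eta> k)"
  have r: "?r \<longlonglongrightarrow> 0"
  proof (rule tendsto_sandwich[OF _ _ tendsto_const log_inv])
    show "\<forall>\<^sub>F k in sequentially. 0 \<le> ?r k"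
      using par
    proof eventually_elim
      case (elim k)
      then have "0 \<le> (of_int \<lceil>log 2 (real (\<tau> k))\<rceil> :: real)"
        using ceiling_log_bounds(5)[of "\<tau> k"] by (metis of_nat_0_le_iff)
      then show ?case by simp
    qed
    show "\<forall>\<^sub>F k in sequentially. ?r k \<le> 2 / log 2 (real k)"
      using par log1
    proof eventually_elim
      case (elim k)
      note p = parameter_bounds[of "\<eta> k" k "\<tau> k"]
      have "log 2 (real (\<tau> k)) \<le> log 2 (real k)" using p elim by simp
      then have "of_int \<lceil>log 2 (real (\<tau> k))\<rceil> \<le> 2 * log 2 (real k)" using elim by linarith
      then have "?r k \<le> 2 * log 2 (real k) / (log 2 (real k))\<^sup>2"
        using elim by (intro frac_le) auto
      also have "\<dots> = 2 / log 2 (real k)" by (simp add: power2_eq_square)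
      finally show ?case .
    qed
  qed
  let ?q = "\<lambda>k. real (\<tau> k) * (real (\<eta> k) * log 2 (real k)) / real k"
  have q: "?q \<longlonglongrightarrow> 0"
    using smalloD_tendsto[OF small] by simp
  have sk: "(\<lambda>k. real (s k) / real k) \<longlonglongrightarrow> 0"
  proof (rule tendsto_sandwich[OF _ _ tendsto_const tendsto_mult_right_zero[OF q, of 7]])
    show "\<forall>\<^sub>F k in sequentially. real (s k) / real k \<le> 7 * ?q k"
      using s log1
    proof eventually_elim
      case (elim k)
      \<comment> \<open>Once \<open>log 2 (real k)\<close> is at least 1, adding 6 to it at most
        multiplies it by 7.\<close>
      have "real (s k) \<le> real (\<eta> k) * real (\<tau> k) * (7 * log 2 (real k))"
        by (rule order_trans[OF elim(1)], rule mult_left_mono) (use elim in auto)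
      then have "real (s k) / real k \<le> real (\<eta> k) * real (\<tau> k) * (7 * log 2 (real k)) / real k"
        by (rule divide_right_mono) simp
      then show ?case by (simp add: mult_ac)
    qed
  qed simp
  have tk: "(\<lambda>k. real (\<tau> k) / real k) \<longlonglongrightarrow> 0"
  proof (rule tendsto_sandwich[OF _ _ tendsto_const q])
    show "\<forall>\<^sub>F k in sequentially. real (\<tau> k) / real k \<le> ?q k"
      using par log1
    proof eventually_elim
      case (elim k)
      have "1 * 1 \<le> real (\<eta> k) * log 2 (real k)" using elim by (intro mult_mono) auto
      then have "real (\<tau> k) * 1 \<le> real (\<tau> k) * (real (\<eta> k) * log 2 (real k))"
        by (intro mult_left_mono) auto
      then show ?case by (simp add: divide_right_mono)
    qed
  qed simp
  have "(\<lambda>k. 1 / (5 * \<beta> ^ 3 * ?r k + 1) *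
      (1 - exp (- ((1 - real (s k) / real k) / (\<beta> * (1 - real (\<tau> k) / real k))))))
    \<longlonglongrightarrow> 1 / (5 * \<beta> ^ 3 * 0 + 1) * (1 - exp (- ((1 - 0) / (\<beta> * (1 - 0)))))"
    using beta by (intro tendsto_intros r sk tk) auto
  moreover have "\<forall>\<^sub>F k in sequentially. 1 / (5 * \<beta> ^ 3 * ?r k + 1) *
      (1 - exp (- ((1 - real (s k) / real k) / (\<beta> * (1 - real (\<tau> k) / real k)))))
    = pro_constant \<beta> k (\<tau> k) (\<eta> k) (s k)"
    using par
  proof eventually_elim
    case (elim k)
    have k: "1 \<le> k" using parameter_bounds[of "\<eta> k" k "\<tau> k"] elim by simp
    have "1 / (5 * \<beta> ^ 3 * ?r k + 1)
        = real (\<eta> k) / (5 * \<beta> ^ 3 * of_int \<lceil>log 2 (real (\<tau> k))\<rceil> + real (\<eta> k))"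
      using elim by (simp add: add_divide_distrib[symmetric] divide_simps)
    moreover have "1 - real (s k) / real k = (real k - real (s k)) / real k"
      "\<beta> * (1 - real (\<tau> k) / real k) = (\<beta> * (real k - real (\<tau> k))) / real k"
      using k by (simp_all add: diff_divide_distrib[symmetric] divide_simps)
    ultimately show ?case using k by (simp add: pro_constant_def minus_divide_left)
  qed
  ultimately show ?thesis by (auto dest: Lim_transform_eventually)
qed

text \<open>Seven terms of the exponential series already exceed 2.718, and 2.718 times 0.368
  exceeds 1.\<close>

lemma exp_neg1_le: "exp (- 1 :: real) \<le> 0.368"
proof -
  have "(\<Sum>n<7. 1 / fact n :: real) \<le> exp 1"
    using sum_le_suminf[OF summable_exp_generic[of "1::real"], of "{..<7}"]
    by (simp add: exp_def divide_inverse)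
  then have "2.718 \<le> exp (1::real)" by (simp add: eval_nat_numeral fact_numeral)
  then show ?thesis by (simp add: exp_minus inverse_eq_divide field_simps)
qed

text \<open>By convexity \<open>exp (- x)\<close> lies below its chord on the unit interval, so
  \<open>1 - exp (- x)\<close> is at least \<open>0.632 * x\<close>. With \<open>x \<le> 1\<close>
  the claim reduces to 0.387 being at most 0.613 times 0.632.\<close>

lemma asymptotic_factor_ge:
  fixes x :: real
  assumes "0 \<le> x" "x \<le> 1"
  shows "0.387 * x \<le> (1 - exp (- x)) / (2 - exp (- x))"
proof -
  have "exp ((1 - x) *\<^sub>R 0 + x *\<^sub>R (- 1 :: real)) \<le> (1 - x) * exp 0 + x * exp (- 1)"
    using assms by (intro convex_onD[OF exp_convex]) auto
  then have "exp (- x) \<le> 1 - x + x * exp (- 1)" by simp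
  also have "\<dots> \<le> 1 - x + x * 0.368"
    using assms exp_neg1_le by (intro add_left_mono mult_left_mono) auto
  finally have e: "0.632 * x \<le> 1 - exp (- x)" by simp
  have "0.387 * x * (2 - exp (- x)) \<le> 1 - exp (- x)"
  proof -
    define w where "w = x * (1 - exp (- x))"
    have "w \<le> 1 * (1 - exp (- x))" unfolding w_def using assms by (intro mult_right_mono) auto
    then have "0.387 * (x + w) \<le> 1 - exp (- x)" using e assms by simp
    also have "x + w = x * (2 - exp (- x))" by (simp add: w_def algebra_simps)
    finally show ?thesis by (simp only: mult.assoc)
  qed
  moreover have "0 < 2 - exp (- x)" using e assms by simp
  ultimately show ?thesis by (simp only: pos_le_divide_eq)
qed

section \<open>Assembly of the finite bound, its limit and the numerical factors\<close>

theorem theorem1: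
  fixes \<beta> :: real
  assumes beta: "\<beta> \<ge> 1"
  shows
  "(\<forall>(V :: 'a set) f A k \<tau> \<eta>.
      finite V \<and> sf_nonneg V f \<and> sf_normalized f \<and> sf_monotone V f \<and> sf_submodular V f
      \<and> valid_subroutine V A \<and> beta_iterative V f A \<beta>
      \<and> k \<le> card V
      \<and> \<eta> > 0 \<and> real \<eta> \<ge> 4 * (log 2 (real k) + 1)
      \<and> 2 \<le> \<tau> \<and> real \<tau> \<le> real k / (3 * real \<eta> * (log 2 (real k) + 2))
      \<longrightarrow> (let S = PRo V k \<tau> \<eta> A;
               c = pro_constant \<beta> k \<tau> \<eta> (card (pro_S0 V \<tau> \<eta> A))
           in card S = k \<and> robust_val f \<tau> S \<ge> c / (1 + c) * opt_robust_val f V k \<tau>))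
   \<and>
   (\<forall>(Vs :: nat \<Rightarrow> 'a set) fs As \<tau>s \<eta>s.
      (\<forall>\<^sub>F k in sequentially.
         finite (Vs k) \<and> sf_nonneg (Vs k) (fs k) \<and> sf_normalized (fs k)
         \<and> sf_monotone (Vs k) (fs k) \<and> sf_submodular (Vs k) (fs k)
         \<and> valid_subroutine (Vs k) (As k) \<and> beta_iterative (Vs k) (fs k) (As k) \<beta>
         \<and> k \<le> card (Vs k)
         \<and> \<eta>s k > 0 \<and> real (\<eta>s k) \<ge> 4 * (log 2 (real k) + 1)
         \<and> 2 \<le> \<tau>s k \<and> real (\<tau>s k) \<le> real k / (3 * real (\<eta>s k) * (log 2 (real k) + 2))
         \<and> real (\<eta>s k) \<ge> (log 2 (real k))\<^sup>2)
      \<and> (\<lambda>k. real (\<tau>s k)) \<in> o(\<lambda>k. real k / (real (\<eta>s k) * log 2 (real k)))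
      \<longrightarrow> (\<exists>\<epsilon> :: nat \<Rightarrow> real. \<epsilon> \<longlonglongrightarrow> 0 \<and>
            (\<forall>\<^sub>F k in sequentially.
               robust_val (fs k) (\<tau>s k) (PRo (Vs k) k (\<tau>s k) (\<eta>s k) (As k))
                 \<ge> ((1 - exp (- 1 / \<beta>)) / (2 - exp (- 1 / \<beta>)) + \<epsilon> k)
                   * opt_robust_val (fs k) (Vs k) k (\<tau>s k))))
   \<and>
   (1 - exp (- 1)) / (2 - exp (- 1)) \<ge> (0.387 :: real)
   \<and>
   (\<forall>\<epsilon> :: real. 0 < \<epsilon> \<and> \<epsilon> < 1 \<longrightarrow>
      (1 - exp (- 1 / (1 / (1 - \<epsilon>)))) / (2 - exp (- 1 / (1 / (1 - \<epsilon>)))) \<ge> 0.387 * (1 - \<epsilon>))"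
proof (intro conjI allI impI)
  fix V :: "'a set" and f A and k \<tau> \<eta> :: nat
  assume "finite V \<and> sf_nonneg V f \<and> sf_normalized f \<and> sf_monotone V f \<and> sf_submodular V f
      \<and> valid_subroutine V A \<and> beta_iterative V f A \<beta>
      \<and> k \<le> card V
      \<and> \<eta> > 0 \<and> real \<eta> \<ge> 4 * (log 2 (real k) + 1)
      \<and> 2 \<le> \<tau> \<and> real \<tau> \<le> real k / (3 * real \<eta> * (log 2 (real k) + 2))"
  note h = this
  interpret iterative_subroutine V f A \<beta> using h beta by (intro iterative_subroutineI) auto
  show "let S = PRo V k \<tau> \<eta> A; c = pro_constant \<beta> k \<tau> \<eta> (card (pro_S0 V \<tau> \<eta> A))
     in card S = k \<and> robust_val f \<tau> S \<ge> c / (1 + c) * opt_robust_val f V k \<tau>"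
    using PRo_guarantee[of k \<eta> \<tau>] h by (simp add: Let_def)
next
  fix Vs :: "nat \<Rightarrow> 'a set" and fs As and \<tau>s \<eta>s :: "nat \<Rightarrow> nat"
  assume asm: "(\<forall>\<^sub>F k in sequentially.
         finite (Vs k) \<and> sf_nonneg (Vs k) (fs k) \<and> sf_normalized (fs k)
         \<and> sf_monotone (Vs k) (fs k) \<and> sf_submodular (Vs k) (fs k)
         \<and> valid_subroutine (Vs k) (As k) \<and> beta_iterative (Vs k) (fs k) (As k) \<beta>
         \<and> k \<le> card (Vs k)
         \<and> \<eta>s k > 0 \<and> real (\<eta>s k) \<ge> 4 * (log 2 (real k) + 1)
         \<and> 2 \<le> \<tau>s k \<and> real (\<tau>s k) \<le> real k / (3 * real (\<eta>s k) * (log 2 (real k) + 2))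
         \<and> real (\<eta>s k) \<ge> (log 2 (real k))\<^sup>2)
      \<and> (\<lambda>k. real (\<tau>s k)) \<in> o(\<lambda>k. real k / (real (\<eta>s k) * log 2 (real k)))"
  let ?s = "\<lambda>k. card (pro_S0 (Vs k) (\<tau>s k) (\<eta>s k) (As k))"
  let ?c = "\<lambda>k. pro_constant \<beta> k (\<tau>s k) (\<eta>s k) (?s k)"
  let ?l = "1 - exp (- 1 / \<beta>)"
  have ev: "\<forall>\<^sub>F k in sequentially.
      real (?s k) \<le> real (\<eta>s k) * real (\<tau>s k) * (log 2 (real k) + 6) \<and>
      ?c k / (1 + ?c k) * opt_robust_val (fs k) (Vs k) k (\<tau>s k)
        \<le> robust_val (fs k) (\<tau>s k) (PRo (Vs k) k (\<tau>s k) (\<eta>s k) (As k))"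
    using conjunct1[OF asm]
  proof eventually_elim
    case (elim k)
    \<comment> \<open>Ground set, function and subroutine vary with \<open>k\<close>, so the finite
      bound is instantiated separately for each \<open>k\<close>.\<close>
    then interpret iterative_subroutine "Vs k" "fs k" "As k" \<beta>
      using beta by (intro iterative_subroutineI) auto
    show ?case using PRo_guarantee[of k "\<eta>s k" "\<tau>s k"] elim by simp
  qed
  have "?c \<longlonglongrightarrow> ?l"
  proof (rule pro_constant_tendsto[OF beta _ _ conjunct2[OF asm]])
    show "\<forall>\<^sub>F k in sequentially. \<eta>s k > 0 \<and> real (\<eta>s k) \<ge> 4 * (log 2 (real k) + 1)
      \<and> 2 \<le> \<tau>s k \<and> real (\<tau>s k) \<le> real k / (3 * real (\<eta>s k) * (log 2 (real k) + 2))
      \<and> real (\<eta>s k) \<ge> (log 2 (real k))\<^sup>2"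
      using conjunct1[OF asm] by eventually_elim simp
    show "\<forall>\<^sub>F k in sequentially.
        real (?s k) \<le> real (\<eta>s k) * real (\<tau>s k) * (log 2 (real k) + 6)"
      using ev by eventually_elim simp
  qed
  moreover have "1 + ?l \<noteq> 0" using beta exp_le_one_iff[of "- 1 / \<beta>"] by fastforce
  ultimately have "(\<lambda>k. ?c k / (1 + ?c k)) \<longlonglongrightarrow> ?l / (1 + ?l)"
    by (intro tendsto_divide tendsto_add tendsto_const)
  \<comment> \<open>The error term is the exact factor at \<open>k\<close> minus its limit, using
    \<open>1 + ?l = 2 - exp (- 1 / \<beta>)\<close>.\<close>
  then have "(\<lambda>k. ?c k / (1 + ?c k) - ?l / (2 - exp (- 1 / \<beta>))) \<longlonglongrightarrow> 0"
    by (simp add: LIM_zero_iff)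
  moreover have "\<forall>\<^sub>F k in sequentially.
      robust_val (fs k) (\<tau>s k) (PRo (Vs k) k (\<tau>s k) (\<eta>s k) (As k))
      \<ge> (?l / (2 - exp (- 1 / \<beta>)) + (?c k / (1 + ?c k) - ?l / (2 - exp (- 1 / \<beta>))))
        * opt_robust_val (fs k) (Vs k) k (\<tau>s k)"
    using ev by eventually_elim simp
  ultimately show "\<exists>\<epsilon> :: nat \<Rightarrow> real. \<epsilon> \<longlonglongrightarrow> 0 \<and>
      (\<forall>\<^sub>F k in sequentially.
         robust_val (fs k) (\<tau>s k) (PRo (Vs k) k (\<tau>s k) (\<eta>s k) (As k))
           \<ge> (?l / (2 - exp (- 1 / \<beta>)) + \<epsilon> k) * opt_robust_val (fs k) (Vs k) k (\<tau>s k))"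
    by blast
next
  show "(1 - exp (- 1)) / (2 - exp (- 1)) \<ge> (0.387 :: real)"
    using asymptotic_factor_ge[of 1] by simp
next
  fix \<epsilon> :: real
  assume "0 < \<epsilon> \<and> \<epsilon> < 1"
  then show "(1 - exp (- 1 / (1 / (1 - \<epsilon>)))) / (2 - exp (- 1 / (1 / (1 - \<epsilon>)))) \<ge> 0.387 * (1 - \<epsilon>)"
    using asymptotic_factor_ge[of "1 - \<epsilon>"] by simp
qed

end
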